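(* Let $G$ be a connected unicyclic graph (a connected graph containing exactly one cycle). Then $H(G)\ge r(G)$, with equality if and only if $G$ is a cycle on an even number of vertices.
   Context: Graphs are finite, simple and undirected. For a graph $G$ with vertex degrees $d_i=\deg(v_i)$, the Harmonic index is $H(G)=\sum_{v_iv_j\in E(G)} \frac{2}{d_i+d_j}$, the sum being over all edges. The radius $r(G)=\min_{v_i\in V}\max_{v_j\in V}\rho(v_i,v_j)$, where $\rho$ is the shortest-path distance. *)

theory Defs
  imports "Graph_Theory.Graph_Theory"
begin

text \<open>
  Finite simple undirected graphs are symmetric loop-free digraphs on pairs
  (\<^locale>\<open>pair_graph\<close>): each edge \<open>{u, v}\<close> is represented by the two arcs \<open>(u, v)\<close> and
  \<open>(v, u)\<close>, so that the degree of a vertex is its out-degree.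
\<close>

definition edges :: "'a pair_pre_digraph \<Rightarrow> 'a set set" where
  "edges G = {{u, v} | u v. (u, v) \<in> parcs G}"

definition harmonic_index :: "'a pair_pre_digraph \<Rightarrow> real" where
  "harmonic_index G = (\<Sum>e \<in> edges G. 2 / (\<Sum>v \<in> e. real (out_degree G v)))"

text \<open>With unit weights, \<open>\<mu>\<close> is the shortest-path distance (infinite if there is no path).\<close>

definition graph_dist :: "'a pair_pre_digraph \<Rightarrow> 'a \<Rightarrow> 'a \<Rightarrow> ereal" where
  "graph_dist G u v = wf_digraph.\<mu> G (\<lambda>_. 1) u v"

definition radius :: "'a pair_pre_digraph \<Rightarrow> ereal" where
  "radius G = Min ((\<lambda>u. Max ((\<lambda>v. graph_dist G u v) ` pverts G)) ` pverts G)"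

text \<open>
  A cycle as a graph. The bound on the length excludes the directed cycles
  \<open>u, v, u\<close> along a single undirected edge.
\<close>

definition cycle_graph :: "'a pair_pre_digraph \<Rightarrow> bool" where
  "cycle_graph C \<longleftrightarrow> (\<exists>p. pre_digraph.cycle C p \<and> length p \<ge> 3 \<and>
     pverts C = fst ` set p \<and> parcs C = set p \<union> (set p)\<inverse>)"

definition unicyclic :: "'a pair_pre_digraph \<Rightarrow> bool" where
  "unicyclic G \<longleftrightarrow> (\<exists>!C. subgraph (with_proj C) (with_proj G) \<and> cycle_graph C)"

end

theory Submission
  imports Defs
begin

text \<open>
  A connected unicyclic graph is its cycle together with a forest of parent pointers leading to it:
  any further edge would close a second cycle. Hence it grows from the cycle, whose index is
  \<open>g / 2\<close>, by attaching leaves. Attaching a leaf never decreases the index; it gains at least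
  \<open>3 / 10\<close> at a cycle vertex of degree 2 and at least \<open>1 / 2\<close> at the end of a tail, so a tail of
  length \<open>k\<close> contributes at least \<open>k / 2 - 1 / 5\<close>.

  Let \<open>v\<close> be a vertex at maximal distance \<open>k\<close> from the cycle and \<open>R\<close> the radius. If \<open>k < R\<close>, a vertex
  far from the root of \<open>v\<close> yields a second tail with another root, and the two tails suffice unless
  \<open>g\<close> is even and \<open>R = g / 2 + k\<close>; in that case every cycle vertex carries a tail of length \<open>k\<close>.
  If \<open>k \<ge> R\<close>, consider the ancestor of \<open>v\<close> at distance \<open>R - 1\<close> from \<open>v\<close>: a vertex far from it is
  not among its descendants and yields a long branch or a second tail.
\<close>

section \<open>Harmonic index of an edge set\<close>

text \<open>Degrees are taken relative to an edge set, so that attaching a leaf is the insertion of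
  one edge; \<open>out_degree_eq_edge_degree\<close> returns to the degrees of the graph.\<close>

definition edge_degree :: "'a set set \<Rightarrow> 'a \<Rightarrow> nat" where
  "edge_degree E v = card {e \<in> E. v \<in> e}"

definition edge_weight :: "'a set set \<Rightarrow> 'a set \<Rightarrow> real" where
  "edge_weight E e = (\<Sum>v\<in>e. real (edge_degree E v))"

definition harmonic :: "'a set set \<Rightarrow> real" where
  "harmonic E = (\<Sum>e\<in>E. 2 / edge_weight E e)"

lemma edge_weight_pair: "a \<noteq> b \<Longrightarrow> edge_weight E {a, b} = real (edge_degree E a) + real (edge_degree E b)"
  by (simp add: edge_weight_def)

lemma edge_degree_insert_leaf:
  assumes "finite E" "v \<notin> \<Union>E" "u \<noteq> v"
  shows "edge_degree (insert {u, v} E) x = edge_degree E x + of_bool (x = u) + of_bool (x = v)"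
proof (cases "x \<in> {u, v}")
  case True
  have "{e \<in> insert {u, v} E. x \<in> e} = insert {u, v} {e \<in> E. x \<in> e}"
    using True by auto
  moreover have "{u, v} \<notin> E" using assms(2) by auto
  ultimately show ?thesis
    using assms True by (auto simp: edge_degree_def)
next
  case False
  then have "{e \<in> insert {u, v} E. x \<in> e} = {e \<in> E. x \<in> e}" by auto
  then show ?thesis using False by (simp add: edge_degree_def)
qed

text \<open>With m the old degree of \<open>u\<close>, the new edge has weight m + 2 and contributes
  2 / (m + 2). Each of the m old edges at \<open>u\<close> grows in weight from some w \<ge> q to w
  + 1 and so loses 2 / (w * (w + 1)), which is at most 2 / (q * (q + 1)).\<close>

lemma harmonic_insert_leaf:
  assumes "finite E" and fe: "\<And>e. e \<in> E \<Longrightarrow> finite e" and v: "v \<notin> \<Union>E" and uv: "u \<noteq> v"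
    and "q > 0" and q: "\<And>e. e \<in> E \<Longrightarrow> u \<in> e \<Longrightarrow> edge_weight E e \<ge> q"
  shows "harmonic (insert {u, v} E) \<ge> harmonic E + 2 / (real (edge_degree E u) + 2)
           - 2 * real (edge_degree E u) / (q * (q + 1))"
proof -
  let ?E = "insert {u, v} E"
  have new: "{u, v} \<notin> E" using v by auto
  have "{e \<in> E. v \<in> e} = {}" using v by auto
  then have dv: "edge_degree E v = 0" unfolding edge_degree_def by (simp only: card.empty)
  have w: "edge_weight ?E e = edge_weight E e + of_bool (u \<in> e)" if e: "e \<in> E" for e
  proof -
    have "v \<notin> e" using e v by auto
    then have "edge_weight ?E e = (\<Sum>x\<in>e. real (edge_degree E x) + (if x = u then 1 else 0))"
      unfolding edge_weight_def edge_degree_insert_leaf[OF assms(1) v uv]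
      by (intro sum.cong) auto
    then show ?thesis using fe[OF e] by (simp add: edge_weight_def sum.distrib)
  qed
  have wn: "edge_weight ?E {u, v} = real (edge_degree E u) + 2"
    unfolding edge_weight_pair[OF uv] edge_degree_insert_leaf[OF assms(1) v uv]
    using uv dv by simp
  let ?D = "{e \<in> E. u \<in> e}"
  have *: "2 / edge_weight ?E e \<ge> 2 / edge_weight E e - of_bool (u \<in> e) * (2 / (q * (q + 1)))"
    if e: "e \<in> E" for e
  proof (cases "u \<in> e")
    case True
    let ?w = "edge_weight E e"
    have qw: "?w \<ge> q" using q[OF e True] .
    then have "2 / ?w - 2 / (?w + 1) = 2 / (?w * (?w + 1))"
      using \<open>q > 0\<close> by (simp add: field_simps)
    also have "\<dots> \<le> 2 / (q * (q + 1))"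
      using qw \<open>q > 0\<close> by (intro divide_left_mono mult_mono mult_pos_pos) auto
    finally show ?thesis using True w[OF e] by simp
  next
    case False
    then show ?thesis using w[OF e] by simp
  qed
  have "harmonic ?E = 2 / (real (edge_degree E u) + 2) + (\<Sum>e\<in>E. 2 / edge_weight ?E e)"
    unfolding harmonic_def using new assms(1) wn by simp
  also have "\<dots> \<ge> 2 / (real (edge_degree E u) + 2)
      + (\<Sum>e\<in>E. 2 / edge_weight E e - of_bool (u \<in> e) * (2 / (q * (q + 1))))"
    using * by (intro add_left_mono sum_mono)
  also have "(\<Sum>e\<in>E. 2 / edge_weight E e - of_bool (u \<in> e) * (2 / (q * (q + 1))))
      = harmonic E - (\<Sum>e\<in>E. of_bool (u \<in> e)) * (2 / (q * (q + 1)))"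
    by (simp add: harmonic_def sum_subtractf sum_distrib_right sum_divide_distrib)
  also have "(\<Sum>e\<in>E. of_bool (u \<in> e)) = real (edge_degree E u)"
    using assms(1) by (simp add: edge_degree_def sum.If_cases of_bool_def Int_def)
  finally show ?thesis by (simp add: algebra_simps)
qed

section \<open>Growing a cycle by leaves\<close>

text \<open>Edges are not part of the data; \<open>grown\<close> rebuilds them from \<open>c\<close>
  and \<open>p\<close>. As \<open>h\<close> drops by one along \<open>p\<close>, the pointers cannot
  loop and reach the cycle after \<open>h v\<close> steps.\<close>

locale cycle_forest =
  fixes c :: "nat \<Rightarrow> 'a" and g :: nat and V :: "'a set" and p :: "'a \<Rightarrow> 'a" and h :: "'a \<Rightarrow> nat"
  assumes g3: "g \<ge> 3" and inj_c: "inj_on c {..<g}" and finV: "finite V"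
    and cV: "c ` {..<g} \<subseteq> V"
    and h0: "v \<in> V \<Longrightarrow> h v = 0 \<longleftrightarrow> v \<in> c ` {..<g}"
    and pV: "v \<in> V \<Longrightarrow> h v > 0 \<Longrightarrow> p v \<in> V"
    and hp: "v \<in> V \<Longrightarrow> h v > 0 \<Longrightarrow> h v = Suc (h (p v))"
begin

definition C where "C = c ` {..<g}"
definition cycle_edge where "cycle_edge i = {c i, c (Suc i mod g)}"
definition cycle_edges where "cycle_edges = cycle_edge ` {..<g}"
definition grown where "grown X = cycle_edges \<union> (\<lambda>x. {p x, x}) ` X"
text \<open>Such a set can be attached to the cycle leaf by leaf, in order of height.\<close>

definition parent_closed where "parent_closed X \<longleftrightarrow> X \<subseteq> V - C \<and> (\<forall>x\<in>X. p x \<in> X \<union> C)"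
definition root where "root v = (p ^^ h v) v"
text \<open>The tail ending in \<open>v\<close>: it contains \<open>v\<close> but not
  \<open>root v\<close>.\<close>

definition ancestors where "ancestors v = (\<lambda>t. (p ^^ t) v) ` {..<h v}"

lemma C_V: "C \<subseteq> V" using cV by (simp add: C_def)
lemma height_eq_0_iff: "v \<in> V \<Longrightarrow> h v = 0 \<longleftrightarrow> v \<in> C" using h0 by (simp add: C_def)
lemma height_pos: "v \<in> V - C \<Longrightarrow> h v > 0" using height_eq_0_iff by auto

section \<open>The bare cycle\<close>

lemma suc_mod: "i < g \<Longrightarrow> Suc i mod g = (if Suc i = g then 0 else Suc i)"
  by auto

lemma suc_mod_less: "Suc i mod g < g" using g3 by simp

lemma c_eq: "i < g \<Longrightarrow> j < g \<Longrightarrow> c i = c j \<longleftrightarrow> i = j"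
  using inj_c by (auto simp: inj_on_def)

text \<open>Two distinct indices with the same edge would be successors of each other modulo
  \<open>g\<close>, which \<open>g3\<close> excludes.\<close>

lemma inj_cycle_edge: "inj_on cycle_edge {..<g}"
proof (rule inj_onI)
  fix i j assume ij: "i \<in> {..<g}" "j \<in> {..<g}" "cycle_edge i = cycle_edge j"
  then have "c i = c j \<or> c i = c (Suc j mod g) \<and> c (Suc i mod g) = c j"
    by (auto simp: cycle_edge_def doubleton_eq_iff)
  then have "i = j \<or> i = Suc j mod g \<and> Suc i mod g = j"
    using ij suc_mod_less by (simp add: c_eq)
  then show "i = j" using ij g3 by (auto simp: suc_mod split: if_splits)
qed

lemma Union_cycle_edges: "\<Union>cycle_edges = C"
  using suc_mod_less by (auto simp: cycle_edges_def cycle_edge_def C_def)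

lemma degree_cycle_edges:
  assumes "v \<in> C" shows "edge_degree cycle_edges v = 2"
proof -
  obtain i where i: "i < g" "v = c i" using assms by (auto simp: C_def)
  \<comment> \<open>The predecessor of \<open>i\<close> around the cycle;
    \<open>cycle_edge j\<close> is the second edge at \<open>c i\<close>.\<close>
  define j where "j = (if i = 0 then g - 1 else i - 1)"
  have j: "j < g" "Suc j mod g = i" "i \<noteq> j" using i g3 by (auto simp: j_def)
  have "{e \<in> cycle_edges. v \<in> e} = cycle_edge ` {i, j}"
  proof (intro equalityI subsetI)
    fix e assume "e \<in> {e \<in> cycle_edges. v \<in> e}"
    then obtain k where k: "k < g" "e = cycle_edge k" "c i = c k \<or> c i = c (Suc k mod g)"
      by (auto simp: cycle_edges_def cycle_edge_def i)
    then have "i = k \<or> i = Suc k mod g" using suc_mod_less i by (simp add: c_eq)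
    then have "k \<in> {i, j}" using k i j by (auto simp: suc_mod split: if_splits)
    then show "e \<in> cycle_edge ` {i, j}" using k by blast
  next
    fix e assume "e \<in> cycle_edge ` {i, j}"
    then show "e \<in> {e \<in> cycle_edges. v \<in> e}"
      using i j by (auto simp: cycle_edges_def cycle_edge_def)
  qed
  moreover have "card (cycle_edge ` {i, j}) = 2"
    using inj_cycle_edge i j by (subst card_image) (auto simp: inj_on_def)
  ultimately show ?thesis by (simp add: edge_degree_def)
qed

lemma cycle_edge_neq: "i < g \<Longrightarrow> c i \<noteq> c (Suc i mod g)"
  using c_eq[of i "Suc i mod g"] suc_mod_less g3 by (auto simp: suc_mod split: if_splits)

lemma harmonic_cycle: "harmonic cycle_edges = g / 2"
proof -
  have "2 / edge_weight cycle_edges e = 1 / 2" if e: "e \<in> cycle_edges" for e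
  proof -
    obtain i where i: "i < g" "e = {c i, c (Suc i mod g)}"
      using e by (auto simp: cycle_edges_def cycle_edge_def)
    have "c i \<in> C" "c (Suc i mod g) \<in> C" using i suc_mod_less by (auto simp: C_def)
    then show ?thesis using i cycle_edge_neq[of i] by (simp add: edge_weight_pair degree_cycle_edges)
  qed
  then have "harmonic cycle_edges = (\<Sum>e\<in>cycle_edges. 1 / 2)"
    unfolding harmonic_def by (intro sum.cong) auto
  also have "\<dots> = g / 2"
    by (simp add: cycle_edges_def card_image[OF inj_cycle_edge])
  finally show ?thesis .
qed

section \<open>Grown edge sets and the gain of a single leaf\<close>

lemma parent_closedD:
  assumes "parent_closed X" "x \<in> X"
  shows "x \<in> V" "x \<notin> C" "p x \<in> X \<union> C" "p x \<in> V" "h x = Suc (h (p x))" "p x \<noteq> x"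
proof -
  show 1: "x \<in> V" "x \<notin> C" "p x \<in> X \<union> C" using assms by (auto simp: parent_closed_def)
  then have "h x > 0" using height_pos by auto
  then show "p x \<in> V" "h x = Suc (h (p x))" using pV hp 1 by auto
  then show "p x \<noteq> x" by auto
qed

lemma finite_grown: "parent_closed X \<Longrightarrow> finite (grown X)"
  using finite_subset[OF _ finV, of X] by (auto simp: grown_def cycle_edges_def parent_closed_def)

lemma Union_grown: "parent_closed X \<Longrightarrow> \<Union>(grown X) = C \<union> X"
  using Union_cycle_edges parent_closedD(3)[of X] by (auto simp: grown_def Union_Un_distrib)

lemma grown_edge_pair:
  assumes "parent_closed X" "e \<in> grown X"
  obtains a b where "e = {a, b}" "a \<noteq> b"
proof (cases "e \<in> cycle_edges")
  case True
  then obtain i where "i < g" "e = {c i, c (Suc i mod g)}"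
    by (auto simp: cycle_edges_def cycle_edge_def)
  then show ?thesis using that cycle_edge_neq by blast
next
  case False
  then obtain x where "x \<in> X" "e = {p x, x}" using assms(2) by (auto simp: grown_def)
  then show ?thesis using that parent_closedD(6)[OF assms(1)] by blast
qed

lemma degree_grown_C:
  assumes "parent_closed X" "v \<in> C" shows "edge_degree (grown X) v \<ge> 2"
proof -
  have "edge_degree cycle_edges v \<le> edge_degree (grown X) v"
    unfolding edge_degree_def using finite_grown[OF assms(1)]
    by (intro card_mono) (auto simp: grown_def)
  then show ?thesis using degree_cycle_edges[OF assms(2)] by simp
qed

lemma degree_grown_pos:
  assumes "parent_closed X" "v \<in> X \<union> C" shows "edge_degree (grown X) v \<ge> 1"
proof -
  have "v \<in> \<Union>(grown X)" using assms Union_grown by auto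
  then have "{e \<in> grown X. v \<in> e} \<noteq> {}" by auto
  then show ?thesis
    unfolding edge_degree_def using finite_grown[OF assms(1)] by (simp add: Suc_le_eq card_gt_0_iff)
qed

text \<open>Off the cycle, \<open>p x\<close> lies on the edge to \<open>x\<close> and on the edge
  to its own parent; these differ because the grandparent is lower than \<open>x\<close>.\<close>

lemma degree_grown_parent:
  assumes X: "parent_closed X" and "x \<in> X" shows "edge_degree (grown X) (p x) \<ge> 2"
proof (cases "p x \<in> C")
  case True
  then show ?thesis using degree_grown_C X by auto
next
  case False
  let ?y = "p x"
  have y: "?y \<in> X" using parent_closedD(3)[OF assms] False by auto
  have "h (p ?y) < h x" using parent_closedD(5)[OF X y] parent_closedD(5)[OF assms] by linarith
  then have "p ?y \<noteq> x" by (metis less_irrefl)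
  then have "{x, ?y} \<noteq> {?y, p ?y}"
    using parent_closedD(6)[OF assms] by (metis doubleton_eq_iff)
  then have "card {{p x, x}, {p ?y, ?y}} = 2"
    by (simp add: insert_commute)
  moreover have "card {{p x, x}, {p ?y, ?y}} \<le> card {e \<in> grown X. ?y \<in> e}"
    using finite_grown[OF X] y assms by (intro card_mono) (auto simp: grown_def)
  ultimately show ?thesis by (simp add: edge_degree_def)
qed

lemma parent_closed_insert:
  assumes "parent_closed X" "x \<in> V - C" "p x \<in> X \<union> C" shows "parent_closed (insert x X)"
  using assms by (auto simp: parent_closed_def)

lemma grown_insert: "grown (insert x X) = insert {p x, x} (grown X)"
  by (auto simp: grown_def)

lemma harmonic_grown_insert:
  assumes X: "parent_closed X" and x: "x \<in> V - C" "x \<notin> X" and px: "p x \<in> X \<union> C"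
    and q: "q > 0" "\<And>e. e \<in> grown X \<Longrightarrow> p x \<in> e \<Longrightarrow> edge_weight (grown X) e \<ge> q"
  shows "harmonic (grown (insert x X)) \<ge> harmonic (grown X)
    + 2 / (real (edge_degree (grown X) (p x)) + 2)
    - 2 * real (edge_degree (grown X) (p x)) / (q * (q + 1))"
  unfolding grown_insert
proof (rule harmonic_insert_leaf[OF finite_grown[OF X]])
  show "finite e" if "e \<in> grown X" for e using grown_edge_pair[OF X that] by auto
  show "x \<notin> \<Union>(grown X)" using x Union_grown[OF X] by auto
  show "p x \<noteq> x" using x px by auto
qed (use q in auto)

lemma weight_grown_ge:
  assumes X: "parent_closed X" and e: "e \<in> grown X" "u \<in> e"
    and ge: "\<And>w. w \<in> e \<Longrightarrow> w \<noteq> u \<Longrightarrow> edge_degree (grown X) w \<ge> k"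
  shows "edge_weight (grown X) e \<ge> real (edge_degree (grown X) u) + real k"
proof -
  obtain a b where ab: "e = {a, b}" "a \<noteq> b" using grown_edge_pair[OF X e(1)] .
  show ?thesis
  proof (cases "u = a")
    case True
    then show ?thesis using ge[of b] ab by (simp add: edge_weight_pair)
  next
    case False
    then show ?thesis using ge[of a] ab e by (simp add: edge_weight_pair)
  qed
qed

text \<open>Neighbours of \<open>p x\<close> have degree at least 1, so q = m + 1 is admissible for
  m the degree of \<open>p x\<close>, and the net gain is at least 2 / ((m + 1) * (m + 2)).\<close>

lemma harmonic_grown_mono_insert:
  assumes X: "parent_closed X" and x: "x \<in> V - C" "x \<notin> X" and px: "p x \<in> X \<union> C"
  shows "harmonic (grown X) \<le> harmonic (grown (insert x X))"
proof -
  let ?m = "real (edge_degree (grown X) (p x))"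
  have "edge_weight (grown X) e \<ge> ?m + 1" if "e \<in> grown X" "p x \<in> e" for e
    using weight_grown_ge[OF X that, of 1] degree_grown_pos[OF X] Union_grown[OF X] that by auto
  from harmonic_grown_insert[OF assms _ this]
  have "harmonic (grown (insert x X)) \<ge> harmonic (grown X) + 2 / (?m + 2) - 2 * ?m / ((?m + 1) * (?m + 1 + 1))"
    by simp
  moreover have "2 / (?m + 2) \<ge> 2 * ?m / ((?m + 1) * (?m + 1 + 1))"
  proof -
    have "2 / (?m + 2) - 2 * ?m / ((?m + 1) * (?m + 1 + 1)) = 2 / ((?m + 1) * (?m + 2))"
      by (subst frac_eq_eq diff_frac_eq, simp, simp add: add_nonneg_eq_0_iff)+ (simp add: algebra_simps)
    also have "\<dots> \<ge> 0" by simp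
    finally show ?thesis by simp
  qed
  ultimately show ?thesis by simp
qed

text \<open>Without an earlier child, \<open>p x\<close> lies only on its two cycle edges, both of
  weight at least 4; with q = 4 the gain is 2 / 4 - 4 / 20.\<close>

lemma harmonic_grown_insert_cycle:
  assumes X: "parent_closed X" and x: "x \<in> V - C" "x \<notin> X" and px: "p x \<in> C"
    and fresh: "\<And>y. y \<in> X \<Longrightarrow> p y \<noteq> p x"
  shows "harmonic (grown (insert x X)) \<ge> harmonic (grown X) + 3 / 10"
proof -
  have on_cycle: "e \<in> cycle_edges" if "e \<in> grown X" "p x \<in> e" for e
    using that fresh[symmetric] px parent_closedD(2)[OF X] by (auto simp: grown_def)
  then have "{e \<in> grown X. p x \<in> e} = {e \<in> cycle_edges. p x \<in> e}"
    by (auto simp: grown_def)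
  then have m: "edge_degree (grown X) (p x) = 2"
    using degree_cycle_edges[OF px] by (simp add: edge_degree_def)
  have "edge_weight (grown X) e \<ge> 4" if e: "e \<in> grown X" "p x \<in> e" for e
    using weight_grown_ge[OF X e, of 2] degree_grown_C[OF X] on_cycle[OF e] Union_cycle_edges m by auto
  from harmonic_grown_insert[OF X x _ _ this] px m show ?thesis by simp
qed

text \<open>Here \<open>p x\<close> is itself a leaf, and its only edge has weight at least 3
  because its parent has degree at least 2; with q = 3 the gain is 2 / 3 - 2 / 12.\<close>

lemma harmonic_grown_insert_leaf:
  assumes X: "parent_closed X" and x: "x \<in> V - C" "x \<notin> X" and px: "p x \<in> X"
    and fresh: "\<And>y. y \<in> X \<Longrightarrow> p y \<noteq> p x"
  shows "harmonic (grown (insert x X)) \<ge> harmonic (grown X) + 1 / 2"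
proof -
  have eq: "e = {p (p x), p x}" if "e \<in> grown X" "p x \<in> e" for e
    using that fresh[symmetric] px parent_closedD(2)[OF X px] Union_cycle_edges by (auto simp: grown_def)
  then have "{e \<in> grown X. p x \<in> e} = {{p (p x), p x}}"
    using px by (auto simp: grown_def)
  then have m: "edge_degree (grown X) (p x) = 1" by (simp add: edge_degree_def)
  have "edge_weight (grown X) e \<ge> 3" if e: "e \<in> grown X" "p x \<in> e" for e
    using weight_grown_ge[OF X e, of 2] eq[OF e] degree_grown_parent[OF X px] m by auto
  from harmonic_grown_insert[OF X x _ _ this] px m show ?thesis by simp
qed

section \<open>Chains of ancestors and whole tails\<close>

lemma parent_pow: "w \<in> V \<Longrightarrow> t \<le> h w \<Longrightarrow> (p ^^ t) w \<in> V \<and> h w = h ((p ^^ t) w) + t"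
proof (induction t)
  case (Suc t)
  then have "(p ^^ t) w \<in> V" "h ((p ^^ t) w) > 0" by auto
  then show ?case using Suc pV hp by fastforce
qed simp

lemma root_C: "w \<in> V \<Longrightarrow> root w \<in> C"
  using parent_pow[of w "h w"] height_eq_0_iff by (auto simp: root_def)

lemma root_ancestor:
  assumes "w \<in> V" "t \<le> h w" shows "root ((p ^^ t) w) = root w"
  using parent_pow[OF assms] assms unfolding root_def
  by (metis add_diff_cancel_right' funpow_add le_add_diff_inverse2 o_apply)

text \<open>The chain is attached from its lowest vertex up to \<open>w\<close>. The first vertex
  gains at least 0, or 3 / 10 at a cycle vertex without children; each of the other b - 1 extends a
  leaf and gains 1 / 2. The induction peels off \<open>w\<close>, which comes last.\<close>

lemma harmonic_attach_chain:
  assumes "parent_closed X" "w \<in> V" "b \<le> h w" "b > 0" "(p ^^ b) w \<in> X \<union> C"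
    and "\<And>t. t < b \<Longrightarrow> (p ^^ t) w \<notin> X \<union> C"
  shows "parent_closed (X \<union> (\<lambda>t. (p ^^ t) w) ` {..<b}) \<and>
    harmonic (grown (X \<union> (\<lambda>t. (p ^^ t) w) ` {..<b})) \<ge> harmonic (grown X) + (real b - 1) / 2
      + (if (p ^^ b) w \<in> C \<and> (\<forall>y\<in>X. p y \<noteq> (p ^^ b) w) then 3 / 10 else 0)"
  using assms(2-)
proof (induction b arbitrary: w)
  case (Suc b)
  note X = assms(1)
  have w: "w \<in> V - C" "w \<notin> X" using Suc.prems(1) Suc.prems(5)[of 0] by auto
  show ?case
  proof (cases "b = 0")
    case True
    then have px: "p w \<in> X \<union> C" using Suc.prems by auto
    have "harmonic (grown (insert w X)) \<ge> harmonic (grown X)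
        + (if p w \<in> C \<and> (\<forall>y\<in>X. p y \<noteq> p w) then 3 / 10 else 0)"
      using harmonic_grown_mono_insert[OF X w px] harmonic_grown_insert_cycle[OF X w] by auto
    then show ?thesis using True parent_closed_insert[OF X w(1) px] by (simp add: lessThan_Suc)
  next
    case False
    let ?u = "p w" and ?Y = "X \<union> (\<lambda>t. (p ^^ t) (p w)) ` {..<b}"
    have u: "?u \<in> V" "h w = Suc (h ?u)" using pV hp height_pos w by auto
    have pu: "(p ^^ t) ?u = (p ^^ Suc t) w" for t by (simp add: funpow_swap1)
    have IH: "parent_closed ?Y \<and> harmonic (grown ?Y) \<ge> harmonic (grown X) + (real b - 1) / 2
      + (if (p ^^ b) ?u \<in> C \<and> (\<forall>y\<in>X. p y \<noteq> (p ^^ b) ?u) then 3 / 10 else 0)"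
      using Suc.prems u False by (intro Suc.IH) (auto simp: pu simp del: funpow.simps)
    have uY: "?u \<in> ?Y" using False by force
    have uX: "?u \<notin> X \<union> C" using Suc.prems(5)[of 1] False by simp
    \<comment> \<open>The chain vertices already attached are lower than \<open>w\<close>, while
      \<open>w\<close> and every child of \<open>p w\<close> have height \<open>h w\<close>; so the
      chain contains neither.\<close>
    have hY: "h y < h w" if y: "y \<in> ?Y - X" for y
    proof -
      obtain t where t: "t < b" "y = (p ^^ t) (p w)" using y by auto
      then show ?thesis using parent_pow[OF u(1), of t] u Suc.prems by auto
    qed
    have wY: "w \<notin> ?Y" using hY w by auto
    have fresh: "p y \<noteq> ?u" if y: "y \<in> ?Y" for y
    proof (cases "y \<in> X")
      case True
      then show ?thesis using parent_closedD(3)[OF X] uX by metis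
    next
      case False
      then have "h y < h w" using hY y by auto
      moreover have "h y = Suc (h (p y))" using parent_closedD(5)[of ?Y y] IH y by auto
      ultimately show ?thesis using u by auto
    qed
    have "harmonic (grown (insert w ?Y)) \<ge> harmonic (grown ?Y) + 1 / 2"
      using harmonic_grown_insert_leaf[OF _ w(1) wY uY fresh] IH by blast
    moreover have "parent_closed (insert w ?Y)"
      using parent_closed_insert[of ?Y w] IH w uY by auto
    moreover have "insert w ?Y = X \<union> (\<lambda>t. (p ^^ t) w) ` {..<Suc b}"
      unfolding lessThan_Suc_eq_insert_0 pu by (simp add: image_image)
    ultimately show ?thesis using IH unfolding pu by (simp add: field_simps)
  qed
qed simp

lemma parent_closed_empty: "parent_closed {}" by (simp add: parent_closed_def)

lemma grown_empty: "grown {} = cycle_edges" by (simp add: grown_def)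

text \<open>The missing vertices are attached one by one, none of them decreasing the index.\<close>

lemma harmonic_grown_le_all:
  assumes "parent_closed X"
  shows "harmonic (grown X) \<le> harmonic (grown (V - C))"
  using assms
proof (induction "card (V - C - X)" arbitrary: X rule: less_induct)
  case less
  show ?case
  proof (cases "V - C \<subseteq> X")
    case True
    then have "X = V - C" using less.prems by (auto simp: parent_closed_def)
    then show ?thesis by simp
  next
    case False
    \<comment> \<open>A missing vertex of least height has its parent already present.\<close>
    then obtain x where x: "x \<in> V - C - X" "\<And>y. y \<in> V - C - X \<Longrightarrow> h x \<le> h y"
      using arg_min_if_finite[of "V - C - X" h] finV by (metis Diff_eq_empty_iff finite_Diff not_less)
    then have "h x > 0" using height_pos by auto
    then have "p x \<in> V" "h (p x) < h x" using pV hp x by fastforce+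
    then have px: "p x \<in> X \<union> C" using x(2)[of "p x"] by auto
    have "card (V - C - insert x X) < card (V - C - X)"
      using x finV by (intro psubset_card_mono) auto
    then have "harmonic (grown (insert x X)) \<le> harmonic (grown (V - C))"
      using less.hyps parent_closed_insert[OF less.prems _ px] x by blast
    then show ?thesis using harmonic_grown_mono_insert[OF less.prems _ _ px] x by fastforce
  qed
qed

text \<open>Distinct roots make the tails disjoint and let each start at a cycle vertex without
  children, so a tail gains 3 / 10 + (h w - 1) / 2.\<close>

lemma harmonic_attach_tails:
  assumes "finite W" "W \<subseteq> V - C" "inj_on root W"
  shows "parent_closed (\<Union>w\<in>W. ancestors w) \<and>
    harmonic (grown (\<Union>w\<in>W. ancestors w)) \<ge> g / 2 + (\<Sum>w\<in>W. h w / 2 - 1 / 5)"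
  using assms
proof (induction W rule: finite_induct)
  case empty
  then show ?case using parent_closed_empty harmonic_cycle grown_empty by simp
next
  case (insert w W)
  let ?X = "\<Union>w\<in>W. ancestors w"
  have IH: "parent_closed ?X" "harmonic (grown ?X) \<ge> g / 2 + (\<Sum>w\<in>W. h w / 2 - 1 / 5)"
    using insert by auto
  have w: "w \<in> V" "h w > 0" using insert.prems height_pos by auto
  have rX: "root y \<in> root ` W" if y: "y \<in> ?X" for y
  proof -
    obtain v t where "v \<in> W" "t < h v" "y = (p ^^ t) v" using y by (auto simp: ancestors_def)
    then show ?thesis using root_ancestor[of v t] insert.prems by auto
  qed
  have rw: "root w \<notin> root ` W" using insert by auto
  have out: "(p ^^ t) w \<notin> ?X \<union> C" if "t < h w" for t
  proof -
    have "root ((p ^^ t) w) = root w" "(p ^^ t) w \<in> V" "h ((p ^^ t) w) > 0"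
      using root_ancestor[of w t] parent_pow[of w t] w that by auto
    then show ?thesis using rw rX[of "(p ^^ t) w"] height_eq_0_iff[of "(p ^^ t) w"] by auto
  qed
  \<comment> \<open>A vertex of \<open>?X\<close> with parent \<open>root w\<close> would have
    height 1 and root \<open>root w\<close>, but no earlier tail has that root.\<close>
  have fresh: "\<forall>y\<in>?X. p y \<noteq> (p ^^ h w) w"
  proof
    fix y assume y: "y \<in> ?X"
    show "p y \<noteq> (p ^^ h w) w"
    proof
      assume "p y = (p ^^ h w) w"
      moreover have "h (root w) = 0" using root_C[OF w(1)] C_V height_eq_0_iff by auto
      ultimately have "h y = 1" "p y = root w"
        using parent_closedD(5)[OF IH(1) y] by (auto simp: root_def)
      then have "root y = root w" by (simp add: root_def)
      then show False using rX[OF y] rw by simp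
    qed
  qed
  have end_C: "(p ^^ h w) w \<in> C" using root_C[OF w(1)] by (simp add: root_def)
  have "parent_closed (?X \<union> ancestors w) \<and>
    harmonic (grown (?X \<union> ancestors w)) \<ge> harmonic (grown ?X) + (real (h w) - 1) / 2 + 3 / 10"
    using harmonic_attach_chain[OF IH(1) w(1) order_refl w(2) _ out] end_C fresh by (simp add: ancestors_def)
  moreover have "(\<Union>w\<in>insert w W. ancestors w) = ?X \<union> ancestors w" by auto
  ultimately show ?case using IH(2) insert.hyps by (simp add: field_simps)
qed

end

section \<open>Comparison with the radius\<close>

text \<open>\<open>d\<close> stands for the graph distance. Its axioms yield upper bounds on
  distances, and these turn vertices at distance at least \<open>R\<close> into upper bounds on
  \<open>R\<close>.\<close>

locale cycle_forest_dist = cycle_forest +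
  fixes d :: "'a \<Rightarrow> 'a \<Rightarrow> nat"
  assumes d_refl: "x \<in> V \<Longrightarrow> d x x = 0"
    and d_sym: "x \<in> V \<Longrightarrow> y \<in> V \<Longrightarrow> d x y = d y x"
    and d_tri: "x \<in> V \<Longrightarrow> y \<in> V \<Longrightarrow> z \<in> V \<Longrightarrow> d x z \<le> d x y + d y z"
    and d_parent: "v \<in> V \<Longrightarrow> h v > 0 \<Longrightarrow> d (p v) v \<le> 1"
    and d_cycle_edge: "i < g \<Longrightarrow> d (c i) (c (Suc i mod g)) \<le> 1"
begin

section \<open>Distances around the cycle and along ancestors\<close>

lemma c_V: "i < g \<Longrightarrow> c i \<in> V" using cV by auto

lemma d_cycle_steps: "a < g \<Longrightarrow> d (c a) (c ((a + k) mod g)) \<le> k"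
proof (induction k)
  case 0
  then show ?case using c_V d_refl by simp
next
  case (Suc k)
  let ?b = "(a + k) mod g"
  have b: "?b < g" using g3 by simp
  have "Suc ?b mod g = (a + Suc k) mod g" by (simp add: mod_Suc_eq)
  then have "d (c ?b) (c ((a + Suc k) mod g)) \<le> 1" using d_cycle_edge[OF b] by simp
  then show ?case
    using d_tri[of "c a" "c ?b" "c ((a + Suc k) mod g)"] Suc c_V b g3 by fastforce
qed

lemma d_cycle:
  assumes "a \<le> b" "b < g"
  shows "d (c a) (c b) \<le> b - a" "d (c a) (c b) \<le> g - (b - a)"
proof -
  show "d (c a) (c b) \<le> b - a"
    using d_cycle_steps[of a "b - a"] assms by simp
  \<comment> \<open>The other arc runs forward from \<open>b\<close> and wraps around to
    \<open>a\<close>.\<close>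
  have "(b + (g - (b - a))) mod g = a"
    using assms by simp
  then show "d (c a) (c b) \<le> g - (b - a)"
    using d_cycle_steps[of b "g - (b - a)"] assms d_sym[of "c a" "c b"] c_V by simp
qed

lemma d_cycle_half:
  assumes "x \<in> C" "y \<in> C" shows "d x y \<le> g div 2"
proof -
  have *: "d (c a) (c b) \<le> g div 2" if "a \<le> b" "b < g" for a b
    using d_cycle[OF that] by linarith
  obtain a b where "a < g" "b < g" "x = c a" "y = c b" using assms by (auto simp: C_def)
  then show ?thesis using *[of a b] *[of b a] d_sym[of x y] c_V by (cases "a \<le> b") auto
qed

text \<open>On an even cycle, distance at least \<open>g div 2\<close> forces both arcs to have
  exactly that length, so the index of \<open>y\<close> determines the opposite one.\<close>

lemma antipode_unique:
  assumes "x \<in> C" "x' \<in> C" "y \<in> C" "even g" "d x y \<ge> g div 2" "d x' y \<ge> g div 2"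
  shows "x = x'"
proof -
  have *: "a = b + g div 2 \<or> b = a + g div 2" if "a < g" "b < g" "d (c a) (c b) \<ge> g div 2" for a b
    using d_cycle[of a b] d_cycle[of b a] that \<open>even g\<close> d_sym[of "c a" "c b"] c_V
    by (cases "a \<le> b") auto
  obtain a a' b where "a < g" "a' < g" "b < g" "x = c a" "x' = c a'" "y = c b"
    using assms by (auto simp: C_def)
  then have "a = b + g div 2 \<or> b = a + g div 2" "a' = b + g div 2 \<or> b = a' + g div 2"
    using * assms by auto
  then have "a = a'" using \<open>a < g\<close> \<open>a' < g\<close> \<open>b < g\<close> \<open>even g\<close> by auto
  then show ?thesis using \<open>x = c a\<close> \<open>x' = c a'\<close> by simp
qed

lemma d_ancestor: "w \<in> V \<Longrightarrow> t \<le> h w \<Longrightarrow> d ((p ^^ t) w) w \<le> t"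
proof (induction t)
  case 0
  then show ?case using d_refl by simp
next
  case (Suc t)
  let ?u = "(p ^^ t) w"
  have u: "?u \<in> V" "h ?u > 0" using parent_pow[of w t] Suc.prems by auto
  then have "d (p ?u) w \<le> d (p ?u) ?u + d ?u w" "p ?u \<in> V" using d_tri pV Suc.prems by auto
  then show ?case using Suc d_parent[OF u] by simp
qed

lemma d_root:
  assumes "x \<in> C" "w \<in> V" shows "d x w \<le> d x (root w) + h w"
proof -
  have "d (root w) w \<le> h w" using d_ancestor[OF assms(2), of "h w"] by (simp add: root_def)
  moreover have "x \<in> V" "root w \<in> V" using assms C_V root_C[OF assms(2)] by auto
  ultimately show ?thesis using d_tri[of x "root w" w] assms(2) by linarith
qed

text \<open>Each tail loses 1 / 5 against half its length. If \<open>w\<close> is on the cycle, the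
  tail of \<open>v\<close> alone suffices, as then \<open>h w = 0\<close>.\<close>

lemma harmonic_two_tails:
  assumes "v \<in> V - C" "w \<in> V" "root w \<noteq> root v"
  shows "harmonic (grown (V - C)) \<ge> (real g + h v + h w) / 2 - 2 / 5"
proof (cases "w \<in> C")
  case True
  then have "h w = 0" using height_eq_0_iff assms by auto
  then show ?thesis
    using harmonic_attach_tails[of "{v}"] assms harmonic_grown_le_all[of "\<Union>w\<in>{v}. ancestors w"]
    by (simp add: add_divide_distrib)
next
  case False
  have "v \<noteq> w" using assms by auto
  then show ?thesis
    using harmonic_attach_tails[of "{v, w}"] assms False harmonic_grown_le_all[of "\<Union>w\<in>{v, w}. ancestors w"]
    by (simp add: add_divide_distrib)
qed

text \<open>The gain of three tails would not suffice for \<open>k = 1\<close>, but an even cycle has at least four vertices.\<close>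

lemma harmonic_gt_antipodal_tails:
  assumes far: "\<And>x. x \<in> C \<Longrightarrow> \<exists>w\<in>V. d x w \<ge> g div 2 + k"
    and max: "\<And>w. w \<in> V \<Longrightarrow> h w \<le> k" and "k > 0" "even g"
  shows "harmonic (grown (V - C)) > g / 2 + k"
proof -
  obtain f where f: "\<And>x. x \<in> C \<Longrightarrow> f x \<in> V \<and> d x (f x) \<ge> g div 2 + k"
    using far by metis
  \<comment> \<open>The distance is at most \<open>g div 2\<close> around the cycle plus a height of
    at most \<open>k\<close>, so both bounds are attained: \<open>f x\<close> has maximal height and
    its root is opposite to \<open>x\<close>.\<close>
  have hf: "h (f x) = k" "d x (root (f x)) \<ge> g div 2" if x: "x \<in> C" for x
    using d_root[OF x, of "f x"] f[OF x] max[of "f x"] d_cycle_half[OF x root_C, of "f x"] by auto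
  have inj: "inj_on (\<lambda>x. root (f x)) C"
    using antipode_unique hf(2) root_C f \<open>even g\<close> by (intro inj_onI) metis
  have fin: "finite C" "card C = g" using inj_c by (auto simp: C_def card_image)
  let ?W = "f ` C"
  have W: "?W \<subseteq> V - C"
    using f hf(1) height_eq_0_iff \<open>k > 0\<close> by fastforce
  have "inj_on f C" "inj_on root ?W"
    using inj by (auto simp: inj_on_def)
  then have "(\<Sum>w\<in>?W. h w / 2 - 1 / 5) = (\<Sum>x\<in>C. k / 2 - 1 / 5)"
    using hf(1) by (simp add: sum.reindex)
  also have "\<dots> = g * (k / 2 - 1 / 5)" using fin by simp
  finally have "harmonic (grown (V - C)) \<ge> g / 2 + g * (k / 2 - 1 / 5)"
    using harmonic_attach_tails[OF _ W \<open>inj_on root ?W\<close>] harmonic_grown_le_all fin by fastforce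
  moreover have "g \<ge> 4" using g3 \<open>even g\<close> by (cases "g = 3") auto
  then have "real g * (k / 2 - 1 / 5) \<ge> 4 * (k / 2 - 1 / 5)"
    using \<open>k > 0\<close> by (intro mult_right_mono) auto
  ultimately show ?thesis using \<open>k > 0\<close> by (simp add: algebra_simps)
qed

text \<open>After the tail of \<open>v\<close>, attach the \<open>b\<close> vertices from
  \<open>w\<close> up to the first meeting point \<open>?u\<close> with that tail or the cycle, for
  a further gain of (b - 1) / 2. Going from \<open>y\<close> up to \<open>?u\<close> and down to
  \<open>w\<close> shows that \<open>b\<close> is at least \<open>d y w - h y\<close>.\<close>

lemma harmonic_branch:
  assumes v: "v \<in> V - C" and w: "w \<in> V" and root: "root w = root v"
    and y: "s < h v" "y = (p ^^ s) v" and nd: "\<And>t. t \<le> h w \<Longrightarrow> (p ^^ t) w \<noteq> y"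
  shows "harmonic (grown (V - C)) \<ge> (real g + h v + d y w - h y) / 2 - 7 / 10"
proof -
  let ?X = "ancestors v"
  have X: "parent_closed ?X" "harmonic (grown ?X) \<ge> g / 2 + (h v / 2 - 1 / 5)"
    using harmonic_attach_tails[of "{v}"] v by auto
  have "(p ^^ h w) w \<in> ?X \<union> C" using root_C[OF w] by (simp add: root_def)
  define b where "b = (LEAST b. (p ^^ b) w \<in> ?X \<union> C)"
  have b: "(p ^^ b) w \<in> ?X \<union> C" "b \<le> h w" "\<And>t. t < b \<Longrightarrow> (p ^^ t) w \<notin> ?X \<union> C"
    unfolding b_def using \<open>(p ^^ h w) w \<in> ?X \<union> C\<close>
    by (rule LeastI, rule Least_le) (rule not_less_Least)
  let ?u = "(p ^^ b) w"
  have u: "?u \<in> V" "h w = h ?u + b" using parent_pow[OF w b(2)] by auto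
  obtain t where t: "t \<le> h v" "?u = (p ^^ t) v"
  proof (cases "?u \<in> C")
    case True
    then have "h ?u = 0" using height_eq_0_iff u by auto
    then have "?u = root w" using u by (simp add: root_def)
    then show ?thesis using root that[of "h v"] by (simp add: root_def)
  next
    case False
    then show ?thesis using b(1) that[OF less_imp_le] by (auto simp: ancestors_def)
  qed
  have hu: "h v = h ?u + t" using parent_pow[of v t] v t by auto
  have yV: "y \<in> V" "h v = h y + s" using parent_pow[of v s] v y by auto
  \<comment> \<open>The meeting point lies strictly above \<open>y\<close>; otherwise
    \<open>y\<close> would be an ancestor of \<open>w\<close>, against \<open>nd\<close>.\<close>
  have "s < t"
  proof (rule ccontr)
    assume "\<not> s < t"
    then have "y = (p ^^ (s - t)) ?u" using t y by (simp add: funpow_add[symmetric, THEN fun_cong, unfolded o_apply])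
    then have "y = (p ^^ (s - t + b)) w" by (simp add: funpow_add)
    moreover have "s - t + b \<le> h w" using u hu \<open>\<not> s < t\<close> y by linarith
    ultimately show False using nd by auto
  qed
  then have "?u = (p ^^ (t - s)) y" using t y by (simp add: funpow_add[symmetric, THEN fun_cong, unfolded o_apply])
  then have "d ?u y \<le> t - s" using d_ancestor[OF yV(1), of "t - s"] hu yV by simp
  then have "d y w \<le> (t - s) + b"
    using d_tri[of y ?u w] d_sym[of y ?u] d_ancestor[OF w b(2)] u yV w by simp
  \<comment> \<open>Here \<open>t - s\<close> is \<open>h y - h ?u\<close>, hence at most
    \<open>h y\<close>.\<close>
  then have dy: "real (d y w) - h y \<le> b"
    using hu yV \<open>s < t\<close> by linarith
  have "harmonic (grown (V - C)) \<ge> g / 2 + (h v / 2 - 1 / 5) + (real b - 1) / 2"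
  proof (cases "b = 0")
    case True
    then show ?thesis using X harmonic_grown_le_all[OF X(1)] by simp
  next
    case False
    let ?Y = "?X \<union> (\<lambda>t. (p ^^ t) w) ` {..<b}"
    have "parent_closed ?Y" "harmonic (grown ?Y) \<ge> harmonic (grown ?X) + (real b - 1) / 2"
      using harmonic_attach_chain[OF X(1) w b(2) _ b(1) b(3)] False by (auto split: if_splits)
    then show ?thesis using X(2) harmonic_grown_le_all[of ?Y] by simp
  qed
  then show ?thesis using dy by (simp add: field_simps)
qed

text \<open>\<open>far\<close> says that all eccentricities are at least \<open>R\<close>, which
  holds for the radius. The gains from tails and branches are compared with \<open>R\<close> through
  distances from \<open>root v\<close> or from an ancestor of \<open>v\<close>.\<close>

theorem harmonic_gt_radius:
  assumes far: "\<And>x. x \<in> V \<Longrightarrow> \<exists>w\<in>V. d x w \<ge> R" and "V \<noteq> C"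
  shows "harmonic (grown (V - C)) > R"
proof -
  let ?H = "harmonic (grown (V - C))"
  have ne: "V - C \<noteq> {}" using C_V \<open>V \<noteq> C\<close> by auto
  obtain v where v: "v \<in> V - C" and mx: "\<And>w. w \<in> V - C \<Longrightarrow> h w \<le> h v"
  proof -
    have "Max (h ` (V - C)) \<in> h ` (V - C)" using ne finV by (intro Max_in) auto
    then obtain v where "v \<in> V - C" "h v = Max (h ` (V - C))" by auto
    then show ?thesis using that[of v] finV by auto
  qed
  have max: "h w \<le> h v" if "w \<in> V" for w
    using mx[of w] height_eq_0_iff[of w] that by (cases "w \<in> C") auto
  have k: "h v > 0" using height_pos v by auto
  \<comment> \<open>The spare 1 in the assumption is worth 1 / 2, more than the loss of 2 / 5 from
    the two tails.\<close>
  have two: "?H > R" if "w \<in> V" "root w \<noteq> root v" "2 * R + 1 \<le> g + h v + h w" for w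
  proof -
    have "2 * real R + 1 \<le> real g + h v + h w"
      using of_nat_mono[OF that(3), where 'a = real] by simp
    then show ?thesis using harmonic_two_tails[OF v that(1,2)] by (simp add: field_simps)
  qed
  show ?thesis
  proof (cases "h v < R")
    case True
    have r: "root v \<in> C" using root_C v by auto
    obtain w where w: "w \<in> V" "d (root v) w \<ge> R" using far[of "root v"] r C_V by auto
    have dw: "d (root v) w \<le> d (root v) (root w) + h w" using d_root[OF r w(1)] .
    \<comment> \<open>With equal roots, \<open>w\<close> would be at distance at most
      \<open>h w\<close> from the root, hence less than \<open>R\<close>.\<close>
    have rne: "root w \<noteq> root v"
    proof
      assume "root w = root v"
      then have "d (root v) w \<le> h w" using dw d_refl r C_V by auto
      then show False using w True max[OF w(1)] by linarith
    qed
    have Rle: "R \<le> g div 2 + h w" using dw w d_cycle_half[OF r root_C[OF w(1)]] by linarith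
    show ?thesis
    \<comment> \<open>Each alternative improves the doubled bound on \<open>R\<close> by at least 1.
      If all fail, \<open>w\<close> has maximal height, \<open>g\<close> is even and
      \<open>R\<close> is extremal.\<close>
    proof (cases "odd g \<or> h w < h v \<or> R < g div 2 + h v")
      case True
      have "2 * R + 1 \<le> g + h v + h w"
        using True Rle max[OF w(1)] by (auto elim!: oddE)
      then show ?thesis using two[OF w(1) rne] by simp
    next
      case False
      then have R: "R = g div 2 + h v" "even g" using Rle max[OF w(1)] by auto
      have "?H > g / 2 + h v"
        using harmonic_gt_antipodal_tails[of "h v"] far C_V max k R by blast
      then show ?thesis using R by auto
    qed
  next
    case False
    show ?thesis
    \<comment> \<open>The case 0 is split off so that \<open>R - 1\<close> below is a true
      predecessor.\<close>
    proof (cases "R = 0")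
      case True
      then show ?thesis using harmonic_attach_tails[of "{v}"] v harmonic_grown_le_all[of "\<Union>w\<in>{v}. ancestors w"] g3 k by simp
    next
      case R0: False
      define y where "y = (p ^^ (R - 1)) v"
      have y: "y \<in> V" "h v = h y + (R - 1)" using parent_pow[of v "R - 1"] v False by (auto simp: y_def)
      obtain w where w: "w \<in> V" "d y w \<ge> R" using far y by auto
      \<comment> \<open>Descendants of \<open>y\<close> have height at most \<open>h v\<close>, so
        they are within distance \<open>R - 1\<close> of \<open>y\<close>.\<close>
      have nd: "(p ^^ t) w \<noteq> y" if "t \<le> h w" for t
      proof
        assume "(p ^^ t) w = y"
        then have "d y w \<le> t" "h w = h y + t" using d_ancestor[OF w(1) that] parent_pow[OF w(1) that] by auto
        then show False using w y max[OF w(1)] R0 by linarith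
      qed
      show ?thesis
      proof (cases "root w = root v")
        case True
        have "?H \<ge> (real g + h v + d y w - h y) / 2 - 7 / 10"
          using harmonic_branch[OF v w(1) True _ y_def nd] False R0 by auto
        moreover have "g + h v + d y w \<ge> 2 * R + 2 + h y" using y w R0 g3 by linarith
        then have "real g + h v + d y w - h y \<ge> 2 * R + 2" by linarith
        ultimately show ?thesis by (simp add: field_simps)
      next
        case rne: False
        have ry: "root y = root v" using root_ancestor[of v "R - 1"] v False by (auto simp: y_def)
        have rC: "root v \<in> C" "root v \<in> V" using root_C[of v] v C_V by auto
        have "d y (root v) \<le> h y"
          using d_ancestor[OF y(1), of "h y"] d_sym[OF y(1) rC(2)] ry by (simp add: root_def)
        moreover have "d y w \<le> d y (root v) + d (root v) w" using d_tri y w rC by auto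
        moreover have "d (root v) w \<le> d (root v) (root w) + h w" using d_root[OF rC(1) w(1)] .
        moreover have "d (root v) (root w) \<le> g div 2" using d_cycle_half[OF rC(1) root_C[OF w(1)]] .
        ultimately have "R \<le> h y + g div 2 + h w" using w by linarith
        \<comment> \<open>Substitute \<open>h v = h y + (R - 1)\<close>; the off-by-one is covered
          by \<open>g - g div 2\<close> being at least 2.\<close>
        then have "g + h v + h w \<ge> 2 * R + 1" using y R0 g3 by linarith
        then show ?thesis using two[OF w(1) rne] by simp
      qed
    qed
  qed
qed

end

section \<open>Unicyclic graphs\<close>

text \<open>Turns a cycle given as a closed list of arcs into a cyclic indexing of its
  vertices.\<close>

lemma pair_cycle_nth:
  assumes "pre_digraph.cycle (with_proj D) q"
  shows "inj_on (\<lambda>i. fst (q ! i)) {..<length q}"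
    and "\<And>i. i < length q \<Longrightarrow> q ! i = (fst (q ! i), fst (q ! (Suc i mod length q)))"
proof -
  interpret D: pair_pre_digraph D .
  obtain u where u: "pcas u q u" "distinct (tl (pawalk_verts u q))" "q \<noteq> []"
    using assms by (auto simp: D.cycle_def D.awalk_def)
  \<comment> \<open>The vertex list is read in two ways, as all arc starts followed by the last end
    and as the first start followed by all arc ends. Equating them shows that each arc ends where
    the next begins.\<close>
  have av: "pawalk_verts u q = map fst q @ [snd (last q)]"
    using D.awalk_verts_conv[of u q] u by simp
  have av': "pawalk_verts u q = fst (hd q) # map snd q"
    using D.awalk_verts_conv'[of u q u] u by simp
  have fu: "fst (hd q) = u" using u by (cases q) auto
  have "snd (last q') = v" if "pcas w q' v" "q' \<noteq> []" for w v and q' :: "('a \<times> 'a) list"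
    using that by (induction q' arbitrary: w) (auto split: if_splits)
  then have su: "snd (last q) = u" using u by blast
  have tl: "map snd q = tl (map fst q) @ [u]"
    using av av' su u(3) by (cases q) auto
  have "distinct (map fst q)"
    using u(2) av' tl fu u(3) by (cases q) auto
  then show "inj_on (\<lambda>i. fst (q ! i)) {..<length q}"
    by (auto simp: distinct_conv_nth inj_on_def)
  show "q ! i = (fst (q ! i), fst (q ! (Suc i mod length q)))" if i: "i < length q" for i
  proof -
    have "snd (q ! i) = (tl (map fst q) @ [u]) ! i" using tl i by (metis nth_map)
    also have "\<dots> = fst (q ! (Suc i mod length q))"
    proof (cases "Suc i = length q")
      case True
      then have "i = length (tl (map fst q))" by simp
      then have "(tl (map fst q) @ [u]) ! i = u" by (simp only: nth_append_length)
      then show ?thesis using True fu u(3) by (simp add: hd_conv_nth)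
    next
      case False
      then have "i < length q - 1" "Suc i mod length q = Suc i" using i by auto
      then show ?thesis by (simp add: nth_append nth_tl)
    qed
    finally show ?thesis by (simp add: prod_eq_iff)
  qed
qed

context pair_graph
begin

section \<open>Degrees, distances and the radius of a symmetric digraph\<close>

lemma parcs_sym: "(u, v) \<in> parcs G \<Longrightarrow> (v, u) \<in> parcs G"
  using pair_sym_arcs by (auto simp: symmetric_def sym_def)

lemma parcs_verts: "(u, v) \<in> parcs G \<Longrightarrow> u \<in> pverts G \<and> v \<in> pverts G \<and> u \<noteq> v"
  using arc_fst_in_verts arc_snd_in_verts pair_no_loops by fastforce

lemma edges_iff: "{u, v} \<in> edges G \<longleftrightarrow> (u, v) \<in> parcs G"
  unfolding edges_def using parcs_sym[of v u] by (auto simp: doubleton_eq_iff)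

lemma out_degree_eq_edge_degree: "out_degree G v = edge_degree (edges G) v"
proof -
  have "bij_betw (\<lambda>e. {fst e, snd e}) (out_arcs G v) {e \<in> edges G. v \<in> e}"
  proof (rule bij_betwI')
    fix a b assume "a \<in> out_arcs G v" "b \<in> out_arcs G v"
    then show "({fst a, snd a} = {fst b, snd b}) = (a = b)"
      by (auto simp: out_arcs_def doubleton_eq_iff prod_eq_iff)
  next
    fix a assume "a \<in> out_arcs G v"
    then show "{fst a, snd a} \<in> {e \<in> edges G. v \<in> e}"
      by (auto simp: out_arcs_def edges_iff)
  next
    fix e assume e: "e \<in> {e \<in> edges G. v \<in> e}"
    then obtain a b where ab: "e = {a, b}" "(a, b) \<in> parcs G" by (auto simp: edges_def)
    then have "e = {v, a} \<and> (v, a) \<in> parcs G \<or> e = {v, b} \<and> (v, b) \<in> parcs G"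
      using e parcs_sym[OF ab(2)] by auto
    then show "\<exists>a\<in>out_arcs G v. e = {fst a, snd a}"
      by (force simp: out_arcs_def)
  qed
  then show ?thesis by (simp add: out_degree_def edge_degree_def bij_betw_same_card)
qed

lemma harmonic_index_eq: "harmonic_index G = harmonic (edges G)"
  by (simp add: harmonic_index_def harmonic_def edge_weight_def out_degree_eq_edge_degree)

text \<open>Junk value: arbitrary if there is no walk from \<open>u\<close> to \<open>v\<close>.\<close>

definition walk_dist :: "'a \<Rightarrow> 'a \<Rightarrow> nat" where
  "walk_dist u v = (LEAST n. \<exists>q. awalk u q v \<and> length q = n)"

lemma walk_dist_le: "awalk u q v \<Longrightarrow> walk_dist u v \<le> length q"
  unfolding walk_dist_def by (rule Least_le) auto

lemma walk_dist_attained: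
  assumes "u \<rightarrow>\<^sup>*\<^bsub>G\<^esub> v" obtains q where "awalk u q v" "length q = walk_dist u v"
proof -
  have "\<exists>n q. awalk u q v \<and> length q = n" using assms unfolding reachable_awalk by blast
  from LeastI_ex[OF this] show ?thesis unfolding walk_dist_def[symmetric] using that by blast
qed

lemma awalk_cost_unit: "awalk_cost (\<lambda>_. 1) q = real (length q)"
  by (induction q) auto

text \<open>\<open>\<mu>\<close> is an infimum of costs over all walks, and a walk with fewest arcs
  attains it.\<close>

lemma graph_dist_eq:
  assumes "u \<rightarrow>\<^sup>*\<^bsub>G\<^esub> v" shows "graph_dist G u v = ereal (walk_dist u v)"
proof -
  obtain q where q: "awalk u q v" "length q = walk_dist u v" using walk_dist_attained[OF assms] .
  show ?thesis unfolding graph_dist_def \<mu>_def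
  proof (rule antisym)
    show "(INF p\<in>{p. awalk u p v}. ereal (awalk_cost (\<lambda>_. 1) p)) \<le> ereal (walk_dist u v)"
      using q by (intro INF_lower2[of q]) (auto simp: awalk_cost_unit)
    show "ereal (walk_dist u v) \<le> (INF p\<in>{p. awalk u p v}. ereal (awalk_cost (\<lambda>_. 1) p))"
      using walk_dist_le by (intro INF_greatest) (auto simp: awalk_cost_unit)
  qed
qed

lemma awalk_rev: "awalk u q v \<Longrightarrow> \<exists>q'. awalk v q' u \<and> length q' = length q"
proof (induction q arbitrary: u)
  case Nil
  then show ?case by (intro exI[of _ "[]"]) (auto simp: awalk_Nil_iff)
next
  case (Cons e q)
  then have e: "e \<in> parcs G" "u = fst e" "awalk (snd e) q v" by (auto simp: awalk_Cons_iff)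
  obtain q' where q': "awalk v q' (snd e)" "length q' = length q" using Cons.IH[OF e(3)] by auto
  have "(snd e, fst e) \<in> parcs G" using e parcs_sym[of "fst e" "snd e"] by auto
  then have "awalk (snd e) [(snd e, fst e)] u" using arc_implies_awalk e by fastforce
  then have "awalk v (q' @ [(snd e, fst e)]) u" using awalk_appendI[OF q'(1)] by auto
  then show ?case using q'(2) by (intro exI[of _ "q' @ [(snd e, fst e)]"]) simp
qed

text \<open>\<open>connected\<close> refers to the symmetric closure, which has the same
  reachability because the arcs are already symmetric.\<close>

lemma connected_reachable:
  assumes "Digraph_Component.connected G" "u \<in> pverts G" "v \<in> pverts G" shows "u \<rightarrow>\<^sup>*\<^bsub>G\<^esub> v"
  using assms reachable_mk_symmetric_eq[OF sym_arcs]
  by (auto simp: connected_def strongly_connected_def mk_symmetric_def)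

text \<open>The minimum and the maxima over the finite nonempty vertex set are attained, and
  connectedness makes all distances finite, so the radius is a natural number.\<close>

lemma radius_cases:
  assumes con: "Digraph_Component.connected G"
  obtains R where "radius G = ereal (real R)"
    "\<And>x. x \<in> pverts G \<Longrightarrow> \<exists>w\<in>pverts G. walk_dist x w \<ge> R"
    "\<exists>x\<in>pverts G. \<forall>w\<in>pverts G. walk_dist x w \<le> R"
proof -
  let ?V = "pverts G"
  let ?ecc = "\<lambda>u. Max ((\<lambda>v. graph_dist G u v) ` ?V)"
  have ne: "?V \<noteq> {}" using con by (auto simp: connected_def strongly_connected_def mk_symmetric_def)
  have gd: "graph_dist G u v = ereal (walk_dist u v)" if "u \<in> ?V" "v \<in> ?V" for u v
    using graph_dist_eq connected_reachable[OF con that] .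
  have ecc_in: "?ecc x \<in> (\<lambda>v. graph_dist G x v) ` ?V" for x
    using ne pair_finite_verts by (intro Max_in) auto
  have "radius G \<in> ?ecc ` ?V" unfolding radius_def
    using ne pair_finite_verts by (intro Min_in) auto
  then obtain x where x: "x \<in> ?V" "radius G = ?ecc x" by auto
  obtain y where y: "y \<in> ?V" "?ecc x = graph_dist G x y" using ecc_in[of x] by auto
  have R: "radius G = ereal (real (walk_dist x y))" using x y gd by simp
  have far: "\<exists>w\<in>?V. walk_dist z w \<ge> walk_dist x y" if z: "z \<in> ?V" for z
  proof -
    have "radius G \<le> ?ecc z" unfolding radius_def using z pair_finite_verts by (intro Min_le) auto
    moreover obtain w where "w \<in> ?V" "?ecc z = graph_dist G z w" using ecc_in[of z] by auto
    ultimately show ?thesis using R gd z by auto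
  qed
  have "walk_dist x w \<le> walk_dist x y" if w: "w \<in> ?V" for w
  proof -
    have "graph_dist G x w \<le> ?ecc x" using w pair_finite_verts by (intro Max_ge) auto
    then have "graph_dist G x w \<le> graph_dist G x y" using y(2) by simp
    then show ?thesis using y(1) gd x w by simp
  qed
  then show ?thesis using that[OF R far] x by blast
qed

text \<open>If deleting the edge leaves its ends connected, a simple path from \<open>y\<close> to
  \<open>x\<close> that avoids the edge is closed by it to a cycle.\<close>

lemma extra_edge_cycle:
  assumes xy: "(x, y) \<in> parcs G" and D: "D = G\<lparr>parcs := parcs G - {(x, y), (y, x)}\<rparr>"
    and reach: "y \<rightarrow>\<^sup>*\<^bsub>with_proj D\<^esub> x"
  shows "\<exists>K. subgraph (with_proj K) (with_proj G) \<and> cycle_graph K \<and> (x, y) \<in> parcs K"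
proof -
  interpret D: pair_wf_digraph D
    using arc_fst_in_verts arc_snd_in_verts by unfold_locales (auto simp: D)
  obtain r where r: "D.apath y r x" using reach D.reachable_apath by auto
  then have rw: "D.awalk y r x" "distinct (pawalk_verts y r)" by (auto simp: D.apath_def)
  define q where "q = (x, y) # r"
  define K where "K = \<lparr>pverts = fst ` set q, parcs = set q \<union> (set q)\<inverse>\<rparr>"
  have rD: "set r \<subseteq> parcs D" "pcas y r x" using rw(1) by (auto simp: D.awalk_def)
  then have rG: "set r \<subseteq> parcs G" by (auto simp: D)
  have "r \<noteq> []" using rw parcs_verts[OF xy] by (auto simp: D.awalk_Nil_iff)
  \<comment> \<open>A path of one arc would be \<open>(y, x)\<close>, which was deleted along with
    \<open>(x, y)\<close>; so the closed walk has at least three arcs.\<close>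
  moreover have "length r \<noteq> 1"
  proof
    assume "length r = 1"
    then obtain a where "r = [a]" by (auto simp: length_Suc_conv)
    then have "(y, x) \<in> parcs D" using rD by (cases a) auto
    then show False by (auto simp: D)
  qed
  ultimately have len: "length q \<ge> 3" by (cases r rule: list.exhaust) (auto simp: q_def Suc_le_eq)
  interpret K: pair_pre_digraph K .
  have "K.awalk x q x" unfolding K.awalk_def using rD(2) by (auto simp: q_def K_def)
  then have cyc: "K.cycle q" using rw(2) by (auto simp: K.cycle_def q_def)
  have snd_in: "snd e \<in> fst ` set q" if e: "e \<in> set q" for e
  proof -
    obtain i where i: "i < length q" "e = q ! i" using e by (auto simp: in_set_conv_nth)
    have "Suc i mod length q < length q" using i(1) by (intro mod_less_divisor) linarith
    moreover have "snd e = fst (q ! (Suc i mod length q))"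
      using pair_cycle_nth(2)[OF cyc i(1)] i(2) by (metis snd_conv)
    ultimately show ?thesis by auto
  qed
  have "set q \<subseteq> parcs G" using rG xy by (simp add: q_def)
  then have KG: "parcs K \<subseteq> parcs G" using parcs_sym by (simp add: K_def) blast
  have "pair_wf_digraph K" using snd_in by unfold_locales (auto simp: K_def intro: rev_image_eqI)
  moreover have "pverts K \<subseteq> pverts G"
  proof
    fix a assume "a \<in> pverts K"
    then obtain e where "e \<in> set q" "a = fst e" by (auto simp: K_def)
    then show "a \<in> pverts G" using \<open>set q \<subseteq> parcs G\<close> arc_fst_in_verts[of e] by auto
  qed
  ultimately have "subgraph (with_proj K) (with_proj G)"
    using KG wf_digraph_wp_iff pair_wf_digraph by (auto simp: subgraph_def compatible_def)
  moreover have "cycle_graph K"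
    unfolding cycle_graph_def using cyc len by (auto simp: K_def)
  moreover have "(x, y) \<in> parcs K" by (simp add: K_def q_def)
  ultimately show ?thesis by blast
qed

text \<open>\<open>h\<close> is the distance to \<open>S\<close>, and \<open>p\<close> takes the
  first step of a shortest walk there.\<close>

lemma nearest_forest:
  assumes con: "Digraph_Component.connected G" and S: "S \<subseteq> pverts G" "S \<noteq> {}"
  obtains h p where "\<And>v. v \<in> pverts G \<Longrightarrow> h v = (0::nat) \<longleftrightarrow> v \<in> S"
    "\<And>v. v \<in> pverts G \<Longrightarrow> h v > 0 \<Longrightarrow> (v, p v) \<in> parcs G \<and> h v = Suc (h (p v))"
proof -
  define h where "h v = (LEAST n. n \<in> walk_dist v ` S)" for v
  have att: "\<exists>s\<in>S. walk_dist v s = h v" for v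
  proof -
    have "\<exists>n. n \<in> walk_dist v ` S" using S(2) by blast
    from LeastI_ex[OF this] have "h v \<in> walk_dist v ` S" by (simp only: h_def)
    then show ?thesis by (metis imageE)
  qed
  have le: "h v \<le> walk_dist v s" if "s \<in> S" for v s
    unfolding h_def using that by (intro Least_le) (rule imageI)
  have dist0: "walk_dist s s = 0" if "s \<in> pverts G" for s
    using walk_dist_le[of s "[]" s] that by (simp add: awalk_Nil_iff)
  have reach: "v \<rightarrow>\<^sup>*\<^bsub>G\<^esub> s" if "v \<in> pverts G" "s \<in> S" for v s
    using connected_reachable[OF con] S that by blast
  have zero: "h v = 0 \<longleftrightarrow> v \<in> S" if v: "v \<in> pverts G" for v
  proof
    assume "h v = 0"
    then obtain s where s: "s \<in> S" "walk_dist v s = 0" using att[of v] by auto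
    obtain q where "awalk v q s" "length q = walk_dist v s" using walk_dist_attained[OF reach[OF v s(1)]] .
    then show "v \<in> S" using s by (simp add: awalk_Nil_iff)
  next
    assume "v \<in> S"
    then show "h v = 0" using le[of v v] dist0[OF v] by simp
  qed
  have parent: "\<exists>y. (v, y) \<in> parcs G \<and> h v = Suc (h y)" if v: "v \<in> pverts G" "h v > 0" for v
  proof -
    obtain s where s: "s \<in> S" "walk_dist v s = h v" using att[of v] by blast
    obtain q where q0: "awalk v q s" "length q = walk_dist v s"
      using walk_dist_attained[OF reach[OF v(1) s(1)]] .
    then have q: "awalk v q s" "length q = h v" using s by simp_all
    have "q \<noteq> []" using q(2) v(2) by auto
    then obtain e q' where e: "q = e # q'" by (cases q) blast+
    have 1: "e \<in> parcs G" "v = fst e" "awalk (snd e) q' s" using q e by (auto simp: awalk_Cons_iff)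
    have "h (snd e) \<le> length q'" using le[OF s(1)] walk_dist_le[OF 1(3)] by (rule order_trans)
    then have up: "Suc (h (snd e)) \<le> h v" using q e by simp
    obtain s' where s': "s' \<in> S" "walk_dist (snd e) s' = h (snd e)" using att[of "snd e"] by blast
    have "snd e \<in> pverts G" using 1 arc_snd_in_verts by auto
    then obtain r where r0: "awalk (snd e) r s'" "length r = walk_dist (snd e) s'"
      using walk_dist_attained[OF reach[OF _ s'(1)]] by blast
    then have r: "awalk (snd e) r s'" "length r = h (snd e)" using s' by simp_all
    \<comment> \<open>Prepending the arc to a shortest walk from its end gives the inequality
      opposite to \<open>up\<close>.\<close>
    have "awalk v (e # r) s'" using 1 r by (auto simp: awalk_Cons_iff)
    then have "h v \<le> Suc (h (snd e))" using le[OF s'(1), of v] walk_dist_le[of v "e # r" s'] r by simp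
    then have "h v = Suc (h (snd e))" using up by linarith
    moreover have "(v, snd e) \<in> parcs G" using 1 by simp
    ultimately show ?thesis by blast
  qed
  \<comment> \<open>The value is arbitrary where \<open>h v\<close> is 0.\<close>
  define p where "p v = (SOME y. (v, y) \<in> parcs G \<and> h v = Suc (h y))" for v
  have "(v, p v) \<in> parcs G \<and> h v = Suc (h (p v))" if "v \<in> pverts G" "h v > 0" for v
    unfolding p_def using parent[OF that] by (rule someI_ex)
  then show ?thesis using that[of h p] zero by blast
qed

text \<open>Gives lower bounds on distances: a function that rises by at most 1 along each arc needs
  long walks to rise far.\<close>

lemma walk_lipschitz:
  fixes f :: "'a \<Rightarrow> nat"
  assumes "\<And>u v. (u, v) \<in> parcs G \<Longrightarrow> f v \<le> Suc (f u)" and "awalk u q v"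
  shows "f v \<le> f u + length q"
  using assms(2)
proof (induction q arbitrary: u)
  case Nil
  then show ?case by (simp add: awalk_Nil_iff)
next
  case (Cons e q)
  then have "e \<in> parcs G" "u = fst e" "awalk (snd e) q v" by (auto simp: awalk_Cons_iff)
  then have "f v \<le> f (snd e) + length q" "f (snd e) \<le> Suc (f u)"
    using Cons.IH assms(1)[of "fst e" "snd e"] by simp_all
  then show ?case by simp
qed

lemma walk_dist_refl: "x \<in> pverts G \<Longrightarrow> walk_dist x x = 0"
  using walk_dist_le[of x "[]" x] by (simp add: awalk_Nil_iff)

lemma walk_dist_arc: "(x, y) \<in> parcs G \<Longrightarrow> walk_dist x y \<le> 1"
  using walk_dist_le[of x "[(x, y)]" y] arc_implies_awalk[of "(x, y)"] by simp

lemma walk_dist_triangle: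
  assumes "x \<rightarrow>\<^sup>*\<^bsub>G\<^esub> y" "y \<rightarrow>\<^sup>*\<^bsub>G\<^esub> z" shows "walk_dist x z \<le> walk_dist x y + walk_dist y z"
proof -
  obtain q where q: "awalk x q y" "length q = walk_dist x y" using walk_dist_attained[OF assms(1)] .
  obtain r where r: "awalk y r z" "length r = walk_dist y z" using walk_dist_attained[OF assms(2)] .
  show ?thesis using walk_dist_le[OF awalk_appendI[OF q(1) r(1)]] q r by simp
qed

lemma walk_dist_sym:
  assumes "x \<rightarrow>\<^sup>*\<^bsub>G\<^esub> y" "y \<rightarrow>\<^sup>*\<^bsub>G\<^esub> x" shows "walk_dist x y = walk_dist y x"
proof -
  have "walk_dist b a \<le> walk_dist a b" if ab: "a \<rightarrow>\<^sup>*\<^bsub>G\<^esub> b" for a b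
  proof -
    obtain q where q: "awalk a q b" "length q = walk_dist a b" using walk_dist_attained[OF ab] .
    obtain q' where q': "awalk b q' a" "length q' = length q" using awalk_rev[OF q(1)] by blast
    show ?thesis using walk_dist_le[OF q'(1)] q'(2) q(2) by simp
  qed
  then show ?thesis using assms by (simp add: antisym)
qed

text \<open>Every vertex is joined to its root by parent edges and every root to \<open>c 0\<close>
  along the cycle. \<open>D\<close> is arbitrary so that it can be the graph with one edge
  deleted.\<close>

lemma grown_reachable:
  assumes "cycle_forest c g (pverts G) p h" and D: "pair_wf_digraph D" "pverts D = pverts G"
    and arcs: "\<And>a b. {a, b} \<in> cycle_forest.grown c g p (pverts G - cycle_forest.C c g) \<Longrightarrow> (a, b) \<in> parcs D"
    and u: "u \<in> pverts G" and v: "v \<in> pverts G"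
  shows "u \<rightarrow>\<^sup>*\<^bsub>with_proj D\<^esub> v"
proof -
  interpret F: cycle_forest c g "pverts G" p h by fact
  interpret D: pair_wf_digraph D by fact
  let ?E = "F.grown (pverts G - F.C)"
  have edge: "a \<rightarrow>\<^sup>*\<^bsub>with_proj D\<^esub> b" "b \<rightarrow>\<^sup>*\<^bsub>with_proj D\<^esub> a" if "{a, b} \<in> ?E" for a b
    using arcs[of a b] arcs[of b a] that by (auto simp: insert_commute intro: D.reachable_adjI)
  have up: "(p ^^ t) x \<rightarrow>\<^sup>*\<^bsub>with_proj D\<^esub> x \<and> x \<rightarrow>\<^sup>*\<^bsub>with_proj D\<^esub> (p ^^ t) x"
    if "x \<in> pverts G" "t \<le> h x" for x t
    using that(2)
  proof (induction t)
    case 0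
    then show ?case using that(1) D(2) D.reachable_refl by simp
  next
    case (Suc t)
    let ?y = "(p ^^ t) x"
    have "?y \<in> pverts G - F.C" using F.parent_pow[of x t] F.height_eq_0_iff[of ?y] that(1) Suc.prems by auto
    then have "{p ?y, ?y} \<in> ?E" by (auto simp: F.grown_def)
    from edge[OF this] have "p ?y \<rightarrow>\<^sup>*\<^bsub>with_proj D\<^esub> x \<and> x \<rightarrow>\<^sup>*\<^bsub>with_proj D\<^esub> p ?y"
      using Suc.IH Suc.prems D.reachable_trans[of "p ?y" ?y x] D.reachable_trans[of x ?y "p ?y"] by simp
    then show ?case by simp
  qed
  have around: "c 0 \<rightarrow>\<^sup>*\<^bsub>with_proj D\<^esub> c i \<and> c i \<rightarrow>\<^sup>*\<^bsub>with_proj D\<^esub> c 0" if "i < g" for i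
    using that
  proof (induction i)
    case 0
    then show ?case using F.cV D(2) D.reachable_refl by auto
  next
    case (Suc i)
    then have "{c i, c (Suc i)} \<in> ?E"
      by (auto simp: F.grown_def F.cycle_edges_def F.cycle_edge_def intro!: rev_image_eqI[of i])
    from edge[OF this] show ?case
      using Suc D.reachable_trans[of "c 0" "c i" "c (Suc i)"] D.reachable_trans[of "c (Suc i)" "c i" "c 0"]
      by simp
  qed
  have "c 0 \<rightarrow>\<^sup>*\<^bsub>with_proj D\<^esub> x \<and> x \<rightarrow>\<^sup>*\<^bsub>with_proj D\<^esub> c 0" if x: "x \<in> pverts G" for x
  proof -
    obtain i where "i < g" "F.root x = c i" using F.root_C[OF x] by (auto simp: F.C_def)
    then show ?thesis
      using up[OF x, of "h x"] around[of i] D.reachable_trans[of "c 0" "c i" x] D.reachable_trans[of x "c i" "c 0"]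
      by (simp add: F.root_def)
  qed
  then show ?thesis using u v D.reachable_trans[of u "c 0" v] by blast
qed

text \<open>The pointers lead to the unique cycle \<open>K\<close>. An edge outside the grown set
  could be deleted without disconnecting the graph, so it would lie on a cycle; by uniqueness that
  cycle is \<open>K\<close>, all of whose edges are in the grown set.\<close>

lemma unicyclic_cycle_forest:
  assumes con: "Digraph_Component.connected G" and "unicyclic G"
  obtains c g p h where "cycle_forest_dist c g (pverts G) p h walk_dist"
    "edges G = cycle_forest.grown c g p (pverts G - cycle_forest.C c g)"
    "cycle_graph G \<longleftrightarrow> pverts G = cycle_forest.C c g"
proof -
  obtain K where K: "subgraph (with_proj K) (with_proj G)" "cycle_graph K"
    and uniq: "\<And>K'. subgraph (with_proj K') (with_proj G) \<Longrightarrow> cycle_graph K' \<Longrightarrow> K' = K"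
    using \<open>unicyclic G\<close> unfolding unicyclic_def by blast
  obtain q where q: "pre_digraph.cycle (with_proj K) q" "length q \<ge> 3"
    "pverts K = fst ` set q" "parcs K = set q \<union> (set q)\<inverse>"
    using K(2) by (auto simp: cycle_graph_def)
  have KG: "pverts K \<subseteq> pverts G" "parcs K \<subseteq> parcs G" using K(1) by (auto simp: subgraph_def)
  define g where "g = length q"
  define c where "c i = fst (q ! i)" for i
  have q_nth: "q ! i = (c i, c (Suc i mod g))" if "i < g" for i
    using pair_cycle_nth(2)[OF q(1)] that by (simp add: c_def g_def)
  have set_q: "set q = (\<lambda>i. (c i, c (Suc i mod g))) ` {..<g}"
    using q_nth by (force simp: set_conv_nth g_def)
  have Cq: "c ` {..<g} = fst ` set q" by (simp add: set_q image_image)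
  have CV: "c ` {..<g} \<subseteq> pverts G" using Cq q(3) KG by simp
  have g3: "g \<ge> 3" using q(2) by (simp add: g_def)
  obtain h p where zero: "\<And>v. v \<in> pverts G \<Longrightarrow> h v = 0 \<longleftrightarrow> v \<in> c ` {..<g}"
    and parent: "\<And>v. v \<in> pverts G \<Longrightarrow> h v > 0 \<Longrightarrow> (v, p v) \<in> parcs G \<and> h v = Suc (h (p v))"
    using nearest_forest[OF con CV] g3 by (metis empty_is_image lessThan_empty_iff not_numeral_le_zero)
  have reach: "u \<rightarrow>\<^sup>*\<^bsub>G\<^esub> v" if "u \<in> pverts G" "v \<in> pverts G" for u v
    using connected_reachable[OF con that] .
  have step: "(c i, c (Suc i mod g)) \<in> parcs G" if "i < g" for i
    using that KG(2) unfolding q(4) set_q by blast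
  interpret F: cycle_forest_dist c g "pverts G" p h walk_dist
  proof unfold_locales
    show "inj_on c {..<g}" using pair_cycle_nth(1)[OF q(1)] by (simp add: c_def[abs_def] g_def)
    show "p v \<in> pverts G" "h v = Suc (h (p v))" if "v \<in> pverts G" "h v > 0" for v
      using parent[OF that] parcs_verts by blast+
    show "walk_dist (p v) v \<le> 1" if "v \<in> pverts G" "h v > 0" for v
      using parent[OF that] parcs_sym walk_dist_arc by blast
    show "walk_dist x y = walk_dist y x" if "x \<in> pverts G" "y \<in> pverts G" for x y
      using walk_dist_sym reach that by blast
    show "walk_dist x z \<le> walk_dist x y + walk_dist y z"
      if "x \<in> pverts G" "y \<in> pverts G" "z \<in> pverts G" for x y z
      using walk_dist_triangle reach that by blast
  qed (use g3 CV zero step walk_dist_arc walk_dist_refl pair_finite_verts in auto)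
  let ?E = "F.grown (pverts G - F.C)"
  have C: "F.C = fst ` set q" using Cq by (simp add: F.C_def)
  have cyc_edges: "{a, b} \<in> F.cycle_edges \<longleftrightarrow> (a, b) \<in> parcs K" for a b
    unfolding q(4) set_q F.cycle_edges_def F.cycle_edge_def by (auto simp: doubleton_eq_iff)
  have forest_edge: "{p x, x} \<in> edges G" if "x \<in> pverts G - F.C" for x
    using that parent[of x] F.height_pos[OF that] parcs_sym[of x "p x"] by (auto simp: edges_iff)
  have "e \<in> edges G" if e: "e \<in> F.cycle_edges" for e
  proof -
    obtain i where "i < g" "e = {c i, c (Suc i mod g)}"
      using e unfolding F.cycle_edges_def F.cycle_edge_def by blast
    then show ?thesis using step edges_iff by simp
  qed
  then have sub: "?E \<subseteq> edges G" using forest_edge by (auto simp: F.grown_def)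
  have "{x, y} \<in> ?E" if xy: "(x, y) \<in> parcs G" for x y
  proof (rule ccontr)
    assume new: "{x, y} \<notin> ?E"
    define D where "D = G\<lparr>parcs := parcs G - {(x, y), (y, x)}\<rparr>"
    have wf: "pair_wf_digraph D"
      using arc_fst_in_verts arc_snd_in_verts by unfold_locales (auto simp: D_def)
    have arcs: "(a, b) \<in> parcs D" if "{a, b} \<in> ?E" for a b
    proof -
      have "{a, b} \<noteq> {x, y}" using that new by metis
      then have "(a, b) \<noteq> (x, y)" "(a, b) \<noteq> (y, x)" by auto
      moreover have "(a, b) \<in> parcs G" using that sub edges_iff by blast
      ultimately show ?thesis by (simp add: D_def)
    qed
    have "y \<rightarrow>\<^sup>*\<^bsub>with_proj D\<^esub> x"
      using grown_reachable[OF F.cycle_forest_axioms wf _ arcs] parcs_verts[OF xy] by (simp add: D_def)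
    then obtain K' where "subgraph (with_proj K') (with_proj G)" "cycle_graph K'" "(x, y) \<in> parcs K'"
      using extra_edge_cycle[OF xy D_def] by blast
    then have "(x, y) \<in> parcs K" using uniq by blast
    then show False using cyc_edges new by (simp add: F.grown_def)
  qed
  then have E: "edges G = ?E" using sub by (auto simp: edges_def)
  \<comment> \<open>A cycle graph is a cycle subgraph of itself, hence equal to \<open>K\<close>;
    conversely, without tree vertices all arcs are those of \<open>K\<close>.\<close>
  have "cycle_graph G \<longleftrightarrow> pverts G = F.C"
  proof
    assume "cycle_graph G"
    moreover have "subgraph (with_proj G) (with_proj G)" using subgraph_refl .
    ultimately have "G = K" using uniq by blast
    then show "pverts G = F.C" using q(3) C by simp
  next
    assume V: "pverts G = F.C"
    then have "edges G = F.cycle_edges" using E by (simp add: F.grown_def)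
    then have "parcs G = parcs K" using cyc_edges edges_iff by auto
    moreover have "pverts G = pverts K" using V q(3) C by simp
    ultimately have "G = K" by simp
    then show "cycle_graph G" using K(2) by simp
  qed
  then show ?thesis using that[OF F.cycle_forest_dist_axioms E] by blast
qed

text \<open>\<open>walk_lipschitz\<close> is applied to the cyclic distance from \<open>x\<close>,
  which reaches \<open>g div 2\<close> at the opposite vertex.\<close>

lemma cycle_eccentricity:
  assumes "cycle_forest_dist c g (pverts G) p h walk_dist"
    and E: "edges G = cycle_forest.cycle_edges c g" and V: "pverts G = cycle_forest.C c g"
    and con: "Digraph_Component.connected G" and x: "x \<in> pverts G"
  shows "\<exists>w\<in>pverts G. walk_dist x w \<ge> g div 2"
proof -
  interpret F: cycle_forest_dist c g "pverts G" p h walk_dist by fact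
  obtain a where a: "a < g" "x = c a" using x V by (auto simp: F.C_def)
  \<comment> \<open>The offset of \<open>b\<close> from \<open>a\<close> around the cycle; adding
    \<open>g - a\<close> avoids truncated subtraction.\<close>
  define k where "k b = (b + (g - a)) mod g" for b
  define f where "f z = (let b = inv_into {..<g} c z in min (k b) (g - k b))" for z
  have fc: "f (c b) = min (k b) (g - k b)" if "b < g" for b
    using that F.inj_c by (simp add: f_def)
  have k_suc: "k (Suc b mod g) = Suc (k b) mod g" for b
    by (simp add: k_def mod_add_left_eq mod_Suc_eq)
  have k_less: "k b < g" for b using a by (simp add: k_def)
  \<comment> \<open>Around the cycle \<open>k\<close> rises by one and drops from
    \<open>g - 1\<close> to 0 at the wrap, so the smaller of \<open>k\<close> and
    \<open>g - k\<close> changes by at most one.\<close>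
  have step: "f (c (Suc b mod g)) \<le> Suc (f (c b)) \<and> f (c b) \<le> Suc (f (c (Suc b mod g)))" if "b < g" for b
    using fc[OF that] fc[OF F.suc_mod_less, of b] k_suc[of b] k_less[of b] F.suc_mod[OF k_less[of b]]
    by (auto simp: min_def split: if_splits)
  have lip: "f v \<le> Suc (f u)" if "(u, v) \<in> parcs G" for u v
  proof -
    have "{u, v} \<in> F.cycle_edges" using that E edges_iff by simp
    then obtain b where "b < g" "{u, v} = {c b, c (Suc b mod g)}"
      by (auto simp: F.cycle_edges_def F.cycle_edge_def)
    then show ?thesis using step[of b] by (auto simp: doubleton_eq_iff)
  qed
  define w where "w = c ((a + g div 2) mod g)"
  have wb: "(a + g div 2) mod g < g" using a by simp
  have w: "w \<in> pverts G" using F.c_V[OF wb] by (simp add: w_def)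
  have "k a = 0" using a by (simp add: k_def)
  then have fx: "f x = 0" using fc[OF a(1)] a by simp
  have "k ((a + g div 2) mod g) = (a + g div 2 + (g - a)) mod g"
    by (simp add: k_def mod_add_left_eq)
  also have "\<dots> = (g div 2 + g) mod g" using a by (simp add: ac_simps)
  also have "\<dots> = g div 2" using a by simp
  finally have fw: "f w = g div 2" using fc[OF wb] by (simp add: w_def)
  obtain r where r: "awalk x r w" "length r = walk_dist x w"
    using walk_dist_attained[OF connected_reachable[OF con x w]] .
  have "f w \<le> f x + length r" using walk_lipschitz[of f, OF lip r(1)] by simp
  then show ?thesis using w r fx fw by auto
qed

end

theorem theorem2:
  fixes G :: "'a pair_pre_digraph"
  assumes "pair_graph G" and "Digraph_Component.connected G" and "unicyclic G"
  shows "ereal (harmonic_index G) \<ge> radius G \<and>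
    (ereal (harmonic_index G) = radius G \<longleftrightarrow> cycle_graph G \<and> even (card (pverts G)))"
proof -
  interpret pair_graph G by fact
  obtain c g p h where F: "cycle_forest_dist c g (pverts G) p h walk_dist"
    and E: "edges G = cycle_forest.grown c g p (pverts G - cycle_forest.C c g)"
    and cyc: "cycle_graph G \<longleftrightarrow> pverts G = cycle_forest.C c g"
    using unicyclic_cycle_forest[OF assms(2,3)] .
  interpret F: cycle_forest_dist c g "pverts G" p h walk_dist by fact
  obtain R where R: "radius G = ereal (real R)"
    and far: "\<And>x. x \<in> pverts G \<Longrightarrow> \<exists>w\<in>pverts G. walk_dist x w \<ge> R"
    and center: "\<exists>x\<in>pverts G. \<forall>w\<in>pverts G. walk_dist x w \<le> R"
    using radius_cases[OF assms(2)] by blast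
  show ?thesis
  proof (cases "pverts G = F.C")
    case False
    \<comment> \<open>The inequality is strict off the cycle, and \<open>cyc\<close> makes the right
      side of the equivalence false as well.\<close>
    then have "harmonic_index G > R"
      using F.harmonic_gt_radius[OF far] E harmonic_index_eq by simp
    then show ?thesis using R cyc False by simp
  next
    case True
    then have Ec: "edges G = F.cycle_edges" using E F.grown_empty by simp
    then have H: "harmonic_index G = g / 2" using harmonic_index_eq F.harmonic_cycle by simp
    have cardV: "card (pverts G) = g" using True F.inj_c by (simp add: F.C_def card_image)
    obtain x where x: "x \<in> pverts G" "\<And>w. w \<in> pverts G \<Longrightarrow> walk_dist x w \<le> R" using center by blast
    obtain w where w: "w \<in> pverts G" "walk_dist x w \<ge> R" using far[OF x(1)] by blast
    have "R \<le> g div 2" using F.d_cycle_half[of x w] x(1) w True by simp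
    moreover have "R \<ge> g div 2"
      using cycle_eccentricity[OF F Ec True assms(2) x(1)] x(2) order_trans by blast
    ultimately have "R = g div 2" by simp
    \<comment> \<open>The radius of a cycle is \<open>g / 2\<close> rounded down, so equality with
      the index is a matter of parity.\<close>
    then have "real R \<le> g / 2" "real R = g / 2 \<longleftrightarrow> even g"
      by (cases "even g"; auto elim!: evenE oddE)+
    then show ?thesis using H R cyc True cardV by auto
  qed
qed

end
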